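(* Every core regular double Stone algebra is isomorphic to a subalgebra of a principal rough set algebra $R_\theta$, for some approximation space $\langle U,\theta\rangle$.
   Context: An approximation space $\langle U,\theta\rangle$ is a nonempty set $U$ with an equivalence relation $\theta$ on $U$; $\theta_x$ denotes the $\theta$-class of $x$. For $X\subseteq U$, $\overline{X}=\bigcup\{\theta_x:\theta_x\cap X\neq\emptyset\}$ and $\underline{X}=\bigcup\{\theta_x:\theta_x\subseteq X\}$; the pair $\langle\underline{X},\overline{X}\rangle$ is a rough set. $R_\theta$ is the set of all rough sets $\langle\underline{X},\overline{X}\rangle$, $X\subseteq U$. Complements $^c$ are taken in $U$. The principal rough set algebra determined by $\langle U,\theta\rangle$, also denoted $R_\theta$, is the algebra $\langle R_\theta,\vee,\wedge,*,+,0,1\rangle$ with $0=\langle\emptyset,\emptyset\rangle$, $1=\langle U,U\rangle$, componentwise union as $\vee$, componentwise intersection as $\wedge$, $\langle\underline{X},\overline{X}\rangle^*=\langle\overline{X}^c,\overline{X}^c\rangle$ and $\langle\underline{X},\overline{X}\rangle^+=\langle\underline{X}^c,\underline{X}^c\rangle$. A double Stone algebra $\langle L,\wedge,\vee,*,+,0,1\rangle$ is a bounded distributive lattice with unary operations $*$ and $+$ such that $y\le x^*\iff y\wedge x=0$, $y\ge x^+\iff y\vee x=1$, $x^*\vee x^{**}=1$ and $x^+\wedge x^{++}=0$. It is regular if $x\wedge x^+\le y\vee y^*$ for all $x,y$. An element $x$ is dense if $x^*=0$ and dually dense if $x^+=1$; the core is the set of elements that are both dense and dually dense. A core regular double Stone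 algebra is a regular double Stone algebra with nonempty core (by regularity the core then has exactly one element, denoted $h$, which may be included in the signature as a constant). Subalgebras and isomorphisms are with respect to $\wedge,\vee,*,+,0,1$ (the core element is then automatically respected).
   Formalization: The algebra is assumed to satisfy 0 ≠ 1: the one-element algebra meets all the axioms of a core regular double Stone algebra, but since U is nonempty every subalgebra of R_θ has 0 ≠ 1, so it is not representable. *)

theory Defs
  imports "HOL-Algebra.Congruence"
begin

section \<open>Double Stone algebras\<close>

record 'a double_stone_alg = "'a partial_object" +
  join :: "'a \<Rightarrow> 'a \<Rightarrow> 'a" (infixl "\<squnion>\<index>" 65)
  meet :: "'a \<Rightarrow> 'a \<Rightarrow> 'a" (infixl "\<sqinter>\<index>" 70)
  star :: "'a \<Rightarrow> 'a" ("\<star>\<index> _" [81] 80)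
  dstar :: "'a \<Rightarrow> 'a" ("\<dagger>\<index> _" [81] 80)
  bottom :: 'a ("\<zero>\<index>")
  top_elem :: 'a ("\<one>\<index>")

text \<open>
  The unary operations \<open>*\<close> (pseudocomplement) and \<open>+\<close> (dual pseudocomplement) are
  written as the prefix operators \<open>\<star>\<close> and \<open>\<dagger>\<close>.
\<close>

definition lat_le :: "('a, 'b) double_stone_alg_scheme \<Rightarrow> 'a \<Rightarrow> 'a \<Rightarrow> bool"
    (infix "\<sqsubseteq>\<index>" 50)
  where "x \<sqsubseteq>\<^bsub>L\<^esub> y \<longleftrightarrow> x \<sqinter>\<^bsub>L\<^esub> y = x"

locale bounded_distributive_lattice =
  fixes L (structure)
  assumes join_closed: "\<lbrakk>x \<in> carrier L; y \<in> carrier L\<rbrakk> \<Longrightarrow> x \<squnion> y \<in> carrier L"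
    and meet_closed: "\<lbrakk>x \<in> carrier L; y \<in> carrier L\<rbrakk> \<Longrightarrow> x \<sqinter> y \<in> carrier L"
    and bottom_closed: "\<zero> \<in> carrier L"
    and top_closed: "\<one> \<in> carrier L"
    and join_commute: "\<lbrakk>x \<in> carrier L; y \<in> carrier L\<rbrakk> \<Longrightarrow> x \<squnion> y = y \<squnion> x"
    and meet_commute: "\<lbrakk>x \<in> carrier L; y \<in> carrier L\<rbrakk> \<Longrightarrow> x \<sqinter> y = y \<sqinter> x"
    and join_assoc: "\<lbrakk>x \<in> carrier L; y \<in> carrier L; z \<in> carrier L\<rbrakk>
      \<Longrightarrow> (x \<squnion> y) \<squnion> z = x \<squnion> (y \<squnion> z)"
    and meet_assoc: "\<lbrakk>x \<in> carrier L; y \<in> carrier L; z \<in> carrier L\<rbrakk>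
      \<Longrightarrow> (x \<sqinter> y) \<sqinter> z = x \<sqinter> (y \<sqinter> z)"
    and join_absorb: "\<lbrakk>x \<in> carrier L; y \<in> carrier L\<rbrakk> \<Longrightarrow> x \<squnion> (x \<sqinter> y) = x"
    and meet_absorb: "\<lbrakk>x \<in> carrier L; y \<in> carrier L\<rbrakk> \<Longrightarrow> x \<sqinter> (x \<squnion> y) = x"
    and meet_join_distrib: "\<lbrakk>x \<in> carrier L; y \<in> carrier L; z \<in> carrier L\<rbrakk>
      \<Longrightarrow> x \<sqinter> (y \<squnion> z) = (x \<sqinter> y) \<squnion> (x \<sqinter> z)"
    and join_bottom: "x \<in> carrier L \<Longrightarrow> x \<squnion> \<zero> = x"
    and meet_top: "x \<in> carrier L \<Longrightarrow> x \<sqinter> \<one> = x"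

locale double_stone_algebra = bounded_distributive_lattice +
  assumes star_closed: "x \<in> carrier L \<Longrightarrow> \<star> x \<in> carrier L"
    and dstar_closed: "x \<in> carrier L \<Longrightarrow> \<dagger> x \<in> carrier L"
    and le_star_iff: "\<lbrakk>x \<in> carrier L; y \<in> carrier L\<rbrakk>
      \<Longrightarrow> y \<sqsubseteq> \<star> x \<longleftrightarrow> y \<sqinter> x = \<zero>"
    and dstar_le_iff: "\<lbrakk>x \<in> carrier L; y \<in> carrier L\<rbrakk>
      \<Longrightarrow> \<dagger> x \<sqsubseteq> y \<longleftrightarrow> y \<squnion> x = \<one>"
    and stone: "x \<in> carrier L \<Longrightarrow> \<star> x \<squnion> \<star> (\<star> x) = \<one>"
    and dual_stone: "x \<in> carrier L \<Longrightarrow> \<dagger> x \<sqinter> \<dagger> (\<dagger> x) = \<zero>"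

locale regular_double_stone_algebra = double_stone_algebra +
  assumes regular: "\<lbrakk>x \<in> carrier L; y \<in> carrier L\<rbrakk>
      \<Longrightarrow> x \<sqinter> \<dagger> x \<sqsubseteq> y \<squnion> \<star> y"

definition dense_elem :: "('a, 'b) double_stone_alg_scheme \<Rightarrow> 'a \<Rightarrow> bool"
  where "dense_elem L x \<longleftrightarrow> x \<in> carrier L \<and> \<star>\<^bsub>L\<^esub> x = \<zero>\<^bsub>L\<^esub>"

definition dually_dense_elem :: "('a, 'b) double_stone_alg_scheme \<Rightarrow> 'a \<Rightarrow> bool"
  where "dually_dense_elem L x \<longleftrightarrow> x \<in> carrier L \<and> \<dagger>\<^bsub>L\<^esub> x = \<one>\<^bsub>L\<^esub>"

definition core :: "('a, 'b) double_stone_alg_scheme \<Rightarrow> 'a set"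
  where "core L = {x. dense_elem L x \<and> dually_dense_elem L x}"

locale core_regular_double_stone_algebra = regular_double_stone_algebra +
  assumes core_nonempty: "core L \<noteq> {}"


section \<open>Subalgebras and isomorphisms\<close>

text \<open>The subalgebra on \<open>S\<close>, as an algebra, is \<open>A\<lparr>carrier := S\<rparr>\<close>.\<close>

definition subalgebra :: "'a set \<Rightarrow> ('a, 'b) double_stone_alg_scheme \<Rightarrow> bool"
  where "subalgebra S A \<longleftrightarrow>
    S \<subseteq> carrier A \<and> \<zero>\<^bsub>A\<^esub> \<in> S \<and> \<one>\<^bsub>A\<^esub> \<in> S \<and>
    (\<forall>x\<in>S. \<forall>y\<in>S. x \<squnion>\<^bsub>A\<^esub> y \<in> S \<and> x \<sqinter>\<^bsub>A\<^esub> y \<in> S) \<and>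
    (\<forall>x\<in>S. \<star>\<^bsub>A\<^esub> x \<in> S \<and> \<dagger>\<^bsub>A\<^esub> x \<in> S)"

definition is_isomorphism ::
    "('a \<Rightarrow> 'c) \<Rightarrow> ('a, 'b) double_stone_alg_scheme \<Rightarrow> ('c, 'd) double_stone_alg_scheme \<Rightarrow> bool"
  where "is_isomorphism f A B \<longleftrightarrow>
    bij_betw f (carrier A) (carrier B) \<and>
    (\<forall>x\<in>carrier A. \<forall>y\<in>carrier A.
      f (x \<squnion>\<^bsub>A\<^esub> y) = f x \<squnion>\<^bsub>B\<^esub> f y \<and> f (x \<sqinter>\<^bsub>A\<^esub> y) = f x \<sqinter>\<^bsub>B\<^esub> f y) \<and>
    (\<forall>x\<in>carrier A.
      f (\<star>\<^bsub>A\<^esub> x) = \<star>\<^bsub>B\<^esub> (f x) \<and> f (\<dagger>\<^bsub>A\<^esub> x) = \<dagger>\<^bsub>B\<^esub> (f x)) \<and>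
    f \<zero>\<^bsub>A\<^esub> = \<zero>\<^bsub>B\<^esub> \<and> f \<one>\<^bsub>A\<^esub> = \<one>\<^bsub>B\<^esub>"

definition isomorphic ::
    "('a, 'b) double_stone_alg_scheme \<Rightarrow> ('c, 'd) double_stone_alg_scheme \<Rightarrow> bool"
  where "isomorphic A B \<longleftrightarrow> (\<exists>f. is_isomorphism f A B)"


section \<open>Rough sets\<close>

text \<open>
  Since \<open>U\<close> is nonempty, \<open>0 = ({}, {})\<close> and \<open>1 = (U, U)\<close> differ in every rough set
  algebra, hence in each of its subalgebras.  The one-element algebra satisfies all axioms of
  core regular double Stone algebras but has \<open>0 = 1\<close>, so it is not representable.
\<close>

definition approximation_space :: "'u set \<Rightarrow> ('u \<times> 'u) set \<Rightarrow> bool"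
  where "approximation_space U \<theta> \<longleftrightarrow> U \<noteq> {} \<and> equiv U \<theta>"

definition upper_approx :: "'u set \<Rightarrow> ('u \<times> 'u) set \<Rightarrow> 'u set \<Rightarrow> 'u set"
  where "upper_approx U \<theta> X = \<Union> {\<theta> `` {x} | x. x \<in> U \<and> \<theta> `` {x} \<inter> X \<noteq> {}}"

definition lower_approx :: "'u set \<Rightarrow> ('u \<times> 'u) set \<Rightarrow> 'u set \<Rightarrow> 'u set"
  where "lower_approx U \<theta> X = \<Union> {\<theta> `` {x} | x. x \<in> U \<and> \<theta> `` {x} \<subseteq> X}"

definition rough_sets :: "'u set \<Rightarrow> ('u \<times> 'u) set \<Rightarrow> ('u set \<times> 'u set) set"
  where "rough_sets U \<theta> = {(lower_approx U \<theta> X, upper_approx U \<theta> X) | X. X \<subseteq> U}"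

definition rough_set_algebra ::
    "'u set \<Rightarrow> ('u \<times> 'u) set \<Rightarrow> ('u set \<times> 'u set) double_stone_alg"
  where "rough_set_algebra U \<theta> =
    \<lparr>carrier = rough_sets U \<theta>,
     join = (\<lambda>(A, B) (C, D). (A \<union> C, B \<union> D)),
     meet = (\<lambda>(A, B) (C, D). (A \<inter> C, B \<inter> D)),
     star = (\<lambda>(A, B). (U - B, U - B)),
     dstar = (\<lambda>(A, B). (U - A, U - A)),
     bottom = ({}, {}),
     top_elem = (U, U)\<rparr>"

end

theory Submission
  imports Defs
begin

text \<open>
  By regularity an element \<open>x\<close> is determined by the pair of its skeletal elements
  \<open>\<dagger> x\<close> and \<open>\<star> x\<close>, and each of these is determined by the prime filters that avoid
  it.  Modifying prime filters only at the core element \<open>h\<close>, which is never skeletal, yields an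
  approximation space whose blocks all have exactly two members, \<open>P - {h}\<close> and
  \<open>insert h P\<close>.  Hence every pair \<open>A \<subseteq> B\<close> of unions of blocks is a rough set:
  it arises from \<open>A\<close> enlarged by one member of each block in \<open>B - A\<close>.
\<close>

section \<open>Prime filters of distributive lattices\<close>

text \<open>One equivalence packs closure under meets (right to left) together with upward closure
  (left to right), because \<open>x \<sqsubseteq> y\<close> means \<open>x \<sqinter> y = x\<close>.
  The whole carrier counts as a filter; properness enters with \<open>prime_filter\<close>.\<close>

definition lat_filter :: "('a, 'b) double_stone_alg_scheme \<Rightarrow> 'a set \<Rightarrow> bool"
  where "lat_filter L F \<longleftrightarrow> F \<subseteq> carrier L \<and> \<one>\<^bsub>L\<^esub> \<in> F \<and>
    (\<forall>x\<in>carrier L. \<forall>y\<in>carrier L. x \<sqinter>\<^bsub>L\<^esub> y \<in> F \<longleftrightarrow> x \<in> F \<and> y \<in> F)"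

definition prime_filter :: "('a, 'b) double_stone_alg_scheme \<Rightarrow> 'a set \<Rightarrow> bool"
  where "prime_filter L F \<longleftrightarrow> lat_filter L F \<and> \<zero>\<^bsub>L\<^esub> \<notin> F \<and>
    (\<forall>x\<in>carrier L. \<forall>y\<in>carrier L. x \<squnion>\<^bsub>L\<^esub> y \<in> F \<longleftrightarrow> x \<in> F \<or> y \<in> F)"

context bounded_distributive_lattice
begin

section \<open>Order theory of bounded distributive lattices\<close>

lemmas closed = join_closed meet_closed bottom_closed top_closed

lemma meet_idem: "x \<in> carrier L \<Longrightarrow> x \<sqinter> x = x"
  by (metis join_bottom meet_absorb bottom_closed)

lemma le_refl: "x \<in> carrier L \<Longrightarrow> x \<sqsubseteq> x"
  by (simp add: lat_le_def meet_idem)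

lemma le_antisym: "\<lbrakk>x \<in> carrier L; y \<in> carrier L; x \<sqsubseteq> y; y \<sqsubseteq> x\<rbrakk> \<Longrightarrow> x = y"
  by (metis lat_le_def meet_commute)

lemma le_trans:
  "\<lbrakk>x \<in> carrier L; y \<in> carrier L; z \<in> carrier L; x \<sqsubseteq> y; y \<sqsubseteq> z\<rbrakk> \<Longrightarrow> x \<sqsubseteq> z"
  by (metis lat_le_def meet_assoc)

lemma le_iff_join: "\<lbrakk>x \<in> carrier L; y \<in> carrier L\<rbrakk> \<Longrightarrow> x \<sqsubseteq> y \<longleftrightarrow> x \<squnion> y = y"
  by (metis lat_le_def meet_commute join_commute join_absorb meet_absorb)

lemma meet_le1: "\<lbrakk>x \<in> carrier L; y \<in> carrier L\<rbrakk> \<Longrightarrow> x \<sqinter> y \<sqsubseteq> x"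
  by (metis lat_le_def meet_commute meet_assoc meet_idem)

lemma meet_le2: "\<lbrakk>x \<in> carrier L; y \<in> carrier L\<rbrakk> \<Longrightarrow> x \<sqinter> y \<sqsubseteq> y"
  by (metis meet_le1 meet_commute)

lemma le_meet_iff: "\<lbrakk>x \<in> carrier L; y \<in> carrier L; z \<in> carrier L\<rbrakk>
    \<Longrightarrow> z \<sqsubseteq> x \<sqinter> y \<longleftrightarrow> z \<sqsubseteq> x \<and> z \<sqsubseteq> y"
  by (metis lat_le_def meet_assoc le_trans meet_le1 meet_le2 meet_closed)

lemma meet_mono: "\<lbrakk>x \<in> carrier L; y \<in> carrier L; x' \<in> carrier L; y' \<in> carrier L;
    x \<sqsubseteq> x'; y \<sqsubseteq> y'\<rbrakk> \<Longrightarrow> x \<sqinter> y \<sqsubseteq> x' \<sqinter> y'"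
  using le_trans[OF meet_closed _ _ meet_le1, of x y x'] le_trans[OF meet_closed _ _ meet_le2, of x y y']
  by (simp only: le_meet_iff meet_closed simp_thms)

lemma le_join1: "\<lbrakk>x \<in> carrier L; y \<in> carrier L\<rbrakk> \<Longrightarrow> x \<sqsubseteq> x \<squnion> y"
  by (simp add: lat_le_def meet_absorb)

lemma le_join2: "\<lbrakk>x \<in> carrier L; y \<in> carrier L\<rbrakk> \<Longrightarrow> y \<sqsubseteq> x \<squnion> y"
  by (metis le_join1 join_commute)

lemma join_le_iff: "\<lbrakk>x \<in> carrier L; y \<in> carrier L; z \<in> carrier L\<rbrakk>
    \<Longrightarrow> x \<squnion> y \<sqsubseteq> z \<longleftrightarrow> x \<sqsubseteq> z \<and> y \<sqsubseteq> z"
  by (metis le_iff_join join_assoc le_trans le_join1 le_join2 join_closed)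

lemma le_top: "x \<in> carrier L \<Longrightarrow> x \<sqsubseteq> \<one>"
  by (simp add: lat_le_def meet_top)

lemma bottom_le: "x \<in> carrier L \<Longrightarrow> \<zero> \<sqsubseteq> x"
  by (metis le_iff_join join_bottom join_commute bottom_closed)

lemma meet_bottom: "x \<in> carrier L \<Longrightarrow> x \<sqinter> \<zero> = \<zero>"
  by (metis bottom_le lat_le_def meet_commute bottom_closed)

lemma join_meet_distrib:
  assumes "x \<in> carrier L" "y \<in> carrier L" "z \<in> carrier L"
  shows "x \<squnion> (y \<sqinter> z) = (x \<squnion> y) \<sqinter> (x \<squnion> z)"
proof -
  have "(x \<squnion> y) \<sqinter> (x \<squnion> z) = ((x \<squnion> y) \<sqinter> x) \<squnion> ((x \<squnion> y) \<sqinter> z)"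
    using assms by (simp add: meet_join_distrib closed)
  also have "(x \<squnion> y) \<sqinter> x = x"
    using assms by (metis meet_commute meet_absorb join_closed)
  also have "(x \<squnion> y) \<sqinter> z = (x \<sqinter> z) \<squnion> (y \<sqinter> z)"
    using assms by (metis meet_commute meet_join_distrib join_closed)
  also have "x \<squnion> ((x \<sqinter> z) \<squnion> (y \<sqinter> z)) = x \<squnion> (y \<sqinter> z)"
    using assms by (metis join_assoc join_absorb meet_closed)
  finally show ?thesis by simp
qed

section \<open>Filters and the prime filter theorem\<close>

lemma filter_up:
  assumes "lat_filter L F" "x \<in> F" "x \<sqsubseteq> y" "y \<in> carrier L"
  shows "y \<in> F"
  using assms unfolding lat_filter_def lat_le_def by (metis subsetD)

text \<open>\<open>G\<close> is the filter generated by \<open>F\<close> and \<open>x\<close>. It is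
  closed under meets because \<open>(f \<sqinter> g) \<sqinter> x\<close> lies below both
  \<open>f \<sqinter> x\<close> and \<open>g \<sqinter> x\<close>.\<close>

lemma filter_adjoin:
  assumes F: "lat_filter L F" and x: "x \<in> carrier L"
  defines "G \<equiv> {z \<in> carrier L. \<exists>f\<in>F. f \<sqinter> x \<sqsubseteq> z}"
  shows "lat_filter L G" "insert x F \<subseteq> G"
proof -
  have Fc: "F \<subseteq> carrier L" and F1: "\<one> \<in> F"
    and Fm: "\<And>f g. f \<in> F \<Longrightarrow> g \<in> F \<Longrightarrow> f \<sqinter> g \<in> F"
    using F by (auto simp: lat_filter_def)
  have meet_mem: "u \<sqinter> v \<in> G" if u: "u \<in> G" and v: "v \<in> G" for u v
  proof -
    obtain f g where fg: "f \<in> F" "f \<sqinter> x \<sqsubseteq> u" "g \<in> F" "g \<sqinter> x \<sqsubseteq> v"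
      and uv: "u \<in> carrier L" "v \<in> carrier L"
      using u v unfolding G_def by auto
    have c: "f \<in> carrier L" "g \<in> carrier L" using fg Fc by auto
    have "(f \<sqinter> g) \<sqinter> x \<sqsubseteq> f \<sqinter> x" "(f \<sqinter> g) \<sqinter> x \<sqsubseteq> g \<sqinter> x"
      using c x by (auto intro!: meet_mono simp: closed meet_le1 meet_le2 le_refl)
    then have "(f \<sqinter> g) \<sqinter> x \<sqsubseteq> u" "(f \<sqinter> g) \<sqinter> x \<sqsubseteq> v"
      using fg c x uv by (meson le_trans meet_closed)+
    then have "(f \<sqinter> g) \<sqinter> x \<sqsubseteq> u \<sqinter> v"
      using c x uv by (simp add: le_meet_iff closed)
    then show ?thesis
      using Fm[OF fg(1,3)] uv unfolding G_def by (auto simp: closed)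
  qed
  have up: "v \<in> G" if "u \<in> G" "u \<sqsubseteq> v" "v \<in> carrier L" for u v
    using that Fc x unfolding G_def by (auto intro: le_trans meet_closed)
  have "\<one> \<in> G"
    using F1 Fc x unfolding G_def by (auto intro!: closed le_top)
  moreover have "u \<sqinter> v \<in> G \<longleftrightarrow> u \<in> G \<and> v \<in> G"
    if "u \<in> carrier L" "v \<in> carrier L" for u v
    using that meet_mem up meet_le1 meet_le2 by blast
  ultimately show "lat_filter L G"
    unfolding lat_filter_def by (auto simp: G_def)
  show "insert x F \<subseteq> G"
    using F1 Fc x unfolding G_def
    by (auto intro: meet_le1 meet_le2 top_closed)
qed

text \<open>If neither \<open>x\<close> nor \<open>y\<close> is in \<open>F\<close>, adjoining
  either one captures \<open>b\<close>, so \<open>f \<sqinter> x\<close> and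
  \<open>g \<sqinter> y\<close> lie below \<open>b\<close> for some \<open>f\<close>,
  \<open>g\<close> in \<open>F\<close>. By distributivity
  \<open>(f \<sqinter> g) \<sqinter> (x \<squnion> y)\<close> then lies below \<open>b\<close>, so
  \<open>x \<squnion> y\<close> cannot be in \<open>F\<close>.\<close>

lemma maximal_filter_prime:
  assumes F: "lat_filter L F" and b: "b \<in> carrier L" "b \<notin> F"
    and max: "\<And>G. lat_filter L G \<Longrightarrow> F \<subseteq> G \<Longrightarrow> b \<notin> G \<Longrightarrow> G = F"
  shows "prime_filter L F"
  unfolding prime_filter_def
proof (intro conjI ballI)
  show "lat_filter L F" by fact
  show "\<zero> \<notin> F" using F b filter_up bottom_le by blast
  have Fc: "F \<subseteq> carrier L" using F by (simp add: lat_filter_def)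
  fix x y assume x: "x \<in> carrier L" and y: "y \<in> carrier L"
  \<comment> \<open>The filter generated by \<open>F\<close> and \<open>z\<close> is strictly larger
    than \<open>F\<close>, so maximality forces it to contain \<open>b\<close>.\<close>
  have meet_le_b: "\<exists>f\<in>F. f \<sqinter> z \<sqsubseteq> b" if z: "z \<in> carrier L" "z \<notin> F" for z
    using filter_adjoin[OF F z(1)] max[OF filter_adjoin(1)[OF F z(1)]] z by blast
  have "x \<in> F \<or> y \<in> F" if j: "x \<squnion> y \<in> F"
  proof (rule ccontr)
    assume "\<not> ?thesis"
    then obtain f g where fg: "f \<in> F" "f \<sqinter> x \<sqsubseteq> b" "g \<in> F" "g \<sqinter> y \<sqsubseteq> b"
      using meet_le_b x y by blast
    have c: "f \<in> carrier L" "g \<in> carrier L" using fg Fc by auto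
    have "(f \<sqinter> g) \<sqinter> x \<sqsubseteq> f \<sqinter> x" "(f \<sqinter> g) \<sqinter> y \<sqsubseteq> g \<sqinter> y"
      using c x y by (auto intro!: meet_mono simp: closed meet_le1 meet_le2 le_refl)
    then have "(f \<sqinter> g) \<sqinter> x \<sqsubseteq> b" "(f \<sqinter> g) \<sqinter> y \<sqsubseteq> b"
      using fg c x y b by (meson le_trans meet_closed)+
    then have "(f \<sqinter> g) \<sqinter> (x \<squnion> y) \<sqsubseteq> b"
      using c x y b by (simp add: meet_join_distrib join_le_iff closed)
    moreover have "(f \<sqinter> g) \<sqinter> (x \<squnion> y) \<in> F"
      using F fg j c x y by (simp add: lat_filter_def closed)
    ultimately show False using F b filter_up by blast
  qed
  then show "x \<squnion> y \<in> F \<longleftrightarrow> x \<in> F \<or> y \<in> F"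
    using filter_up[OF F _ le_join1[OF x y]] filter_up[OF F _ le_join2[OF x y]]
      join_closed[OF x y] by blast
qed

text \<open>Zorn's lemma, applied to the filters that contain \<open>a\<close> and omit
  \<open>b\<close>, yields a maximal one, which is prime. The principal filter of \<open>a\<close>
  shows that there are such filters.\<close>

lemma prime_filter_separation:
  assumes a: "a \<in> carrier L" and b: "b \<in> carrier L" and ab: "\<not> a \<sqsubseteq> b"
  obtains F where "prime_filter L F" "a \<in> F" "b \<notin> F"
proof -
  let ?A = "{F. lat_filter L F \<and> a \<in> F \<and> b \<notin> F}"
  have "\<exists>M\<in>?A. \<forall>X\<in>?A. M \<subseteq> X \<longrightarrow> X = M"
  proof (rule subset_Zorn_nonempty)
    have "lat_filter L {z \<in> carrier L. a \<sqsubseteq> z}"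
      using a by (auto simp: lat_filter_def le_meet_iff le_top closed)
    then show "?A \<noteq> {}" using a b ab le_refl by blast
    fix \<C> assume ne: "\<C> \<noteq> {}" and chain: "subset.chain ?A \<C>"
    have fil: "lat_filter L F" "a \<in> F" "b \<notin> F" if "F \<in> \<C>" for F
      using that chain by (auto simp: subset.chain_def)
    have "x \<sqinter> y \<in> \<Union>\<C> \<longleftrightarrow> x \<in> \<Union>\<C> \<and> y \<in> \<Union>\<C>"
      if xy: "x \<in> carrier L" "y \<in> carrier L" for x y
    proof
      assume "x \<sqinter> y \<in> \<Union>\<C>"
      then show "x \<in> \<Union>\<C> \<and> y \<in> \<Union>\<C>"
        using fil(1) xy unfolding lat_filter_def by blast
    next
      assume "x \<in> \<Union>\<C> \<and> y \<in> \<Union>\<C>"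
      then obtain F G where "F \<in> \<C>" "G \<in> \<C>" "x \<in> F" "y \<in> G" by blast
      moreover from this have "F \<subseteq> G \<or> G \<subseteq> F"
        using chain by (auto simp: subset.chain_def)
      ultimately obtain H where "H \<in> \<C>" "x \<in> H" "y \<in> H" by blast
      then show "x \<sqinter> y \<in> \<Union>\<C>"
        using fil(1) xy unfolding lat_filter_def by blast
    qed
    moreover have "\<Union>\<C> \<subseteq> carrier L" "\<one> \<in> \<Union>\<C>"
      using ne fil(1) unfolding lat_filter_def by blast+
    ultimately show "\<Union>\<C> \<in> ?A"
      using ne fil(2,3) by (auto simp: lat_filter_def)
  qed
  then obtain M where "M \<in> ?A" and max: "\<forall>X\<in>?A. M \<subseteq> X \<longrightarrow> X = M" by blast
  then have M: "lat_filter L M" "a \<in> M" "b \<notin> M" by auto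
  moreover have "prime_filter L M"
    using M b max by (intro maximal_filter_prime[of M b]) auto
  ultimately show ?thesis using that by blast
qed

lemma eq_if_prime_filters_agree:
  assumes "a \<in> carrier L" "b \<in> carrier L"
    and "\<And>F. prime_filter L F \<Longrightarrow> a \<in> F \<longleftrightarrow> b \<in> F"
  shows "a = b"
  using assms by (metis le_antisym prime_filter_separation)

end


section \<open>Skeletal elements of double Stone algebras\<close>

text \<open>The order dual, with the two complements exchanged. It turns each law of
  \<open>\<star>\<close> into a law of \<open>\<dagger>\<close>.\<close>

definition dual_algebra ::
    "('a, 'b) double_stone_alg_scheme \<Rightarrow> ('a, 'b) double_stone_alg_scheme"
  where "dual_algebra L = L\<lparr>join := meet L, meet := join L, star := dstar L, dstar := star L,
    bottom := top_elem L, top_elem := bottom L\<rparr>"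

lemma dual_algebra_simps [simp]:
  "carrier (dual_algebra L) = carrier L"
  "join (dual_algebra L) = meet L"
  "meet (dual_algebra L) = join L"
  "star (dual_algebra L) = dstar L"
  "dstar (dual_algebra L) = star L"
  "bottom (dual_algebra L) = top_elem L"
  "top_elem (dual_algebra L) = bottom L"
  by (simp_all add: dual_algebra_def)

context double_stone_algebra
begin

lemmas skel_closed = closed star_closed dstar_closed

lemma dual_le: "\<lbrakk>x \<in> carrier L; y \<in> carrier L\<rbrakk> \<Longrightarrow> x \<sqsubseteq>\<^bsub>dual_algebra L\<^esub> y \<longleftrightarrow> y \<sqsubseteq> x"
  by (simp add: lat_le_def[of "dual_algebra L"] le_iff_join join_commute)

text \<open>The axioms come in dual pairs except for distributivity, whose dual form is
  \<open>join_meet_distrib\<close>.\<close>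

lemma double_stone_algebra_dual: "double_stone_algebra (dual_algebra L)"
  by unfold_locales
    (simp_all add: skel_closed join_assoc meet_assoc join_absorb meet_absorb join_meet_distrib
      join_bottom meet_top dual_le le_star_iff dstar_le_iff stone dual_stone,
     simp_all add: join_commute meet_commute)

section \<open>Laws of the pseudocomplement and their duals\<close>

lemma star_meet_self: "x \<in> carrier L \<Longrightarrow> \<star> x \<sqinter> x = \<zero>"
  using le_star_iff le_refl star_closed by blast

lemma star_antimono:
  assumes "x \<in> carrier L" "y \<in> carrier L" "x \<sqsubseteq> y"
  shows "\<star> y \<sqsubseteq> \<star> x"
proof -
  have "\<star> y \<sqinter> x \<sqsubseteq> \<star> y \<sqinter> y"
    using assms by (intro meet_mono) (auto simp: skel_closed le_refl)
  then have "\<star> y \<sqinter> x = \<zero>"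
    using assms by (intro le_antisym) (auto simp: star_meet_self skel_closed bottom_le)
  then show ?thesis using assms by (simp add: le_star_iff star_closed)
qed

lemma star_join:
  assumes "x \<in> carrier L" "y \<in> carrier L"
  shows "\<star> (x \<squnion> y) = \<star> x \<sqinter> \<star> y"
proof (rule le_antisym)
  have "\<star> x \<sqinter> \<star> y \<sqsubseteq> \<star> x" "\<star> x \<sqinter> \<star> y \<sqsubseteq> \<star> y"
    using assms by (auto intro: meet_le1 meet_le2 star_closed)
  then show "\<star> x \<sqinter> \<star> y \<sqsubseteq> \<star> (x \<squnion> y)"
    using assms by (simp add: le_star_iff skel_closed meet_join_distrib join_bottom)
qed (use assms in \<open>auto simp: skel_closed le_meet_iff star_antimono le_join1 le_join2\<close>)

text \<open>This De Morgan law rests on the Stone identity. Write \<open>z\<close> for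
  \<open>\<star> (x \<sqinter> y)\<close> and split it along
  \<open>\<star> y \<squnion> \<star> (\<star> y) = \<one>\<close>. The first piece is below
  \<open>\<star> y\<close>. The second is below \<open>\<star> x\<close>: since
  \<open>z \<sqinter> x\<close> is below \<open>\<star> y\<close>, meeting it with
  \<open>\<star> (\<star> y)\<close> gives \<open>\<zero>\<close>.\<close>

lemma star_meet:
  assumes x: "x \<in> carrier L" and y: "y \<in> carrier L"
  shows "\<star> (x \<sqinter> y) = \<star> x \<squnion> \<star> y"
proof (rule le_antisym)
  let ?z = "\<star> (x \<sqinter> y)"
  have z: "?z \<in> carrier L" using x y by (simp add: skel_closed)
  have "(?z \<sqinter> x) \<sqinter> y = \<zero>"
    using x y z star_meet_self[of "x \<sqinter> y"] by (simp add: meet_assoc skel_closed)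
  then have zx: "?z \<sqinter> x \<sqsubseteq> \<star> y"
    using x y z by (simp add: le_star_iff skel_closed)
  have "(?z \<sqinter> \<star> (\<star> y)) \<sqinter> x = (?z \<sqinter> x) \<sqinter> \<star> (\<star> y)"
    using x y z by (metis meet_assoc meet_commute star_closed)
  also have "\<dots> \<sqsubseteq> \<star> y \<sqinter> \<star> (\<star> y)"
    using x y z zx by (intro meet_mono) (auto simp: skel_closed le_refl)
  also have "\<star> y \<sqinter> \<star> (\<star> y) = \<zero>"
    using y by (metis star_meet_self meet_commute star_closed)
  finally have "(?z \<sqinter> \<star> (\<star> y)) \<sqinter> x = \<zero>"
    using x y z by (intro le_antisym) (auto simp: skel_closed bottom_le)
  then have 1: "?z \<sqinter> \<star> (\<star> y) \<sqsubseteq> \<star> x"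
    using x y z by (simp add: le_star_iff skel_closed)
  have 2: "?z \<sqinter> \<star> y \<sqsubseteq> \<star> y"
    using y z by (simp add: meet_le2 skel_closed)
  have "?z = ?z \<sqinter> (\<star> y \<squnion> \<star> (\<star> y))"
    using y z by (simp add: stone meet_top)
  also have "\<dots> = (?z \<sqinter> \<star> y) \<squnion> (?z \<sqinter> \<star> (\<star> y))"
    using y z by (simp add: meet_join_distrib skel_closed)
  also have "\<dots> \<sqsubseteq> \<star> x \<squnion> \<star> y"
  proof -
    have "?z \<sqinter> \<star> (\<star> y) \<sqsubseteq> \<star> x \<squnion> \<star> y" "?z \<sqinter> \<star> y \<sqsubseteq> \<star> x \<squnion> \<star> y"
      using le_trans[OF _ _ _ 1 le_join1] le_trans[OF _ _ _ 2 le_join2] x y z skel_closed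
      by presburger+
    then show ?thesis using x y z by (simp only: join_le_iff skel_closed)
  qed
  finally show "?z \<sqsubseteq> \<star> x \<squnion> \<star> y" .
  have "\<star> x \<sqsubseteq> ?z" "\<star> y \<sqsubseteq> ?z"
    using x y by (intro star_antimono meet_le1 meet_le2; simp add: skel_closed)+
  then show "\<star> x \<squnion> \<star> y \<sqsubseteq> ?z"
    using x y z by (simp only: join_le_iff skel_closed)
qed (use x y skel_closed in auto)

lemma star_bottom: "\<star> \<zero> = \<one>"
  by (rule le_antisym) (auto simp: skel_closed le_top le_star_iff meet_bottom)

lemma star_top: "\<star> \<one> = \<zero>"
  using star_meet_self[of \<one>] by (simp add: meet_top skel_closed)

text \<open>If \<open>\<star> x = h\<close>, density of \<open>h\<close> reduces the Stone identity
  for \<open>x\<close> to \<open>h = \<one>\<close>. Dual density then gives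
  \<open>\<dagger> \<one> = \<one>\<close>, whereas
  \<open>\<dagger> \<one> = \<zero>\<close>.\<close>

lemma core_not_star:
  assumes h: "h \<in> core L" and nontriv: "\<zero> \<noteq> \<one>" and x: "x \<in> carrier L"
  shows "\<star> x \<noteq> h"
proof
  assume eq: "\<star> x = h"
  have "\<star> h = \<zero>" "\<dagger> h = \<one>"
    using h by (auto simp: core_def dense_elem_def dually_dense_elem_def)
  then have "h = \<one>"
    using stone[OF x] eq star_closed[OF x] by (simp add: join_bottom)
  then have "\<dagger> \<one> = \<one>" using \<open>\<dagger> h = \<one>\<close> by simp
  moreover have "\<dagger> \<one> = \<zero>"
    using double_stone_algebra.star_bottom[OF double_stone_algebra_dual] by simp
  ultimately show False using nontriv by simp
qed

lemma core_dual: "core (dual_algebra L) = core L"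
  by (auto simp: core_def dense_elem_def dually_dense_elem_def)

text \<open>Each law is its \<open>star\<close> counterpart read in the dual algebra, so
  \<open>top\<close> trades places with \<open>bottom\<close> and \<open>join\<close> with
  \<open>meet\<close> in the names.\<close>

lemmas dstar_bottom = double_stone_algebra.star_top[OF double_stone_algebra_dual, simplified]
  and dstar_top = double_stone_algebra.star_bottom[OF double_stone_algebra_dual, simplified]
  and dstar_join = double_stone_algebra.star_meet[OF double_stone_algebra_dual, simplified]
  and dstar_meet = double_stone_algebra.star_join[OF double_stone_algebra_dual, simplified]
  and dstar_join_self =
    double_stone_algebra.star_meet_self[OF double_stone_algebra_dual, simplified]
  and core_not_dstar =
    double_stone_algebra.core_not_star[OF double_stone_algebra_dual, simplified, unfolded core_dual]

text \<open>Splitting \<open>\<star> x\<close> along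
  \<open>x \<squnion> \<dagger> x = \<one>\<close>, the part below \<open>x\<close> vanishes. This
  is what puts the first component of \<open>rough_rep\<close> inside the second.\<close>

lemma star_le_dstar:
  assumes x: "x \<in> carrier L"
  shows "\<star> x \<sqsubseteq> \<dagger> x"
proof -
  have "\<star> x = \<star> x \<sqinter> (x \<squnion> \<dagger> x)"
    using x by (metis dstar_join_self join_commute meet_top star_closed dstar_closed)
  also have "\<dots> = \<star> x \<sqinter> \<dagger> x"
    using x join_bottom[of "\<star> x \<sqinter> \<dagger> x"] join_commute[of \<zero> "\<star> x \<sqinter> \<dagger> x"]
    by (simp add: meet_join_distrib star_meet_self skel_closed)
  finally show ?thesis by (simp add: lat_le_def)
qed

text \<open>Both \<open>\<star> (\<star> x)\<close> and \<open>\<dagger> (\<star> x)\<close> are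
  complements of \<open>\<star> x\<close>, and a prime filter contains exactly one of two
  complementary elements.\<close>

lemma prime_star_star:
  assumes "prime_filter L F" "x \<in> carrier L"
  shows "\<star> (\<star> x) \<in> F \<longleftrightarrow> \<star> x \<notin> F" "\<dagger> (\<star> x) \<in> F \<longleftrightarrow> \<star> x \<notin> F"
proof -
  have c: "\<star> x \<in> carrier L" "\<star> (\<star> x) \<in> carrier L" "\<dagger> (\<star> x) \<in> carrier L"
    using assms(2) by (auto simp: skel_closed)
  have one: "\<one> \<in> F" and zero: "\<zero> \<notin> F"
    using assms(1) by (auto simp: prime_filter_def lat_filter_def)
  have join: "u \<squnion> v \<in> F \<longleftrightarrow> u \<in> F \<or> v \<in> F" and meet: "u \<sqinter> v \<in> F \<longleftrightarrow> u \<in> F \<and> v \<in> F"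
    if "u \<in> carrier L" "v \<in> carrier L" for u v
    using assms(1) that by (auto simp: prime_filter_def lat_filter_def)
  show star: "\<star> (\<star> x) \<in> F \<longleftrightarrow> \<star> x \<notin> F"
    using one zero join[OF c(1,2)] meet[OF c(2,1)]
      stone[OF assms(2)] star_meet_self[OF c(1)] by auto
  \<comment> \<open>\<open>\<dagger> (\<star> x)\<close> is the least element whose join with
    \<open>\<star> x\<close> is \<open>\<one>\<close>, and by the Stone identity
    \<open>\<star> (\<star> x)\<close> is such an element.\<close>
  have "\<dagger> (\<star> x) \<sqsubseteq> \<star> (\<star> x)"
    using c stone[OF assms(2)] by (simp add: dstar_le_iff join_commute)
  then show "\<dagger> (\<star> x) \<in> F \<longleftrightarrow> \<star> x \<notin> F"
    using star one join[OF c(3,1)] dstar_join_self[OF c(1)] meet[OF c(3,2)]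
    by (auto simp: lat_le_def)
qed

text \<open>The same argument for the complemented element \<open>\<dagger> x\<close>. It is carried
  out directly because the prime filters of \<open>dual_algebra L\<close> are the prime ideals of
  \<open>L\<close>, so duality would not speak of the same \<open>F\<close>.\<close>

lemma prime_dstar_dstar:
  assumes "prime_filter L F" "x \<in> carrier L"
  shows "\<dagger> (\<dagger> x) \<in> F \<longleftrightarrow> \<dagger> x \<notin> F" "\<star> (\<dagger> x) \<in> F \<longleftrightarrow> \<dagger> x \<notin> F"
proof -
  have c: "\<dagger> x \<in> carrier L" "\<dagger> (\<dagger> x) \<in> carrier L" "\<star> (\<dagger> x) \<in> carrier L"
    using assms(2) by (auto simp: skel_closed)
  have one: "\<one> \<in> F" and zero: "\<zero> \<notin> F"
    using assms(1) by (auto simp: prime_filter_def lat_filter_def)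
  have join: "u \<squnion> v \<in> F \<longleftrightarrow> u \<in> F \<or> v \<in> F" and meet: "u \<sqinter> v \<in> F \<longleftrightarrow> u \<in> F \<and> v \<in> F"
    if "u \<in> carrier L" "v \<in> carrier L" for u v
    using assms(1) that by (auto simp: prime_filter_def lat_filter_def)
  show dstar: "\<dagger> (\<dagger> x) \<in> F \<longleftrightarrow> \<dagger> x \<notin> F"
    using one zero join[OF c(2,1)] meet[OF c(1,2)]
      dual_stone[OF assms(2)] dstar_join_self[OF c(1)] by auto
  have "\<dagger> (\<dagger> x) \<sqsubseteq> \<star> (\<dagger> x)"
    using c dual_stone[OF assms(2)] by (simp add: le_star_iff meet_commute)
  then show "\<star> (\<dagger> x) \<in> F \<longleftrightarrow> \<dagger> x \<notin> F"
    using dstar zero meet[OF c(3,1)] star_meet_self[OF c(1)] meet[OF c(2,3)]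
    by (auto simp: lat_le_def)
qed

end

text \<open>Splitting \<open>x\<close> along \<open>y \<squnion> \<dagger> y = \<one>\<close> leaves
  \<open>x \<sqinter> y\<close> and \<open>x \<sqinter> \<dagger> x\<close>. Regularity bounds the
  latter by \<open>x \<sqinter> (y \<squnion> \<star> y)\<close>, which equals
  \<open>x \<sqinter> y\<close> because \<open>\<star> y = \<star> x\<close>. So
  \<open>x \<sqsubseteq> y\<close>, and the roles are symmetric.\<close>

lemma (in regular_double_stone_algebra) regular_eqI:
  assumes "x \<in> carrier L" "y \<in> carrier L" "\<star> x = \<star> y" "\<dagger> x = \<dagger> y"
  shows "x = y"
proof -
  have le: "x \<sqsubseteq> y" if x: "x \<in> carrier L" and y: "y \<in> carrier L"
    and s: "\<star> x = \<star> y" and d: "\<dagger> x = \<dagger> y" for x y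
  proof -
    have "x \<sqinter> \<dagger> x \<sqsubseteq> x \<sqinter> (y \<squnion> \<star> y)"
      using x y regular by (simp add: le_meet_iff skel_closed meet_le1)
    also have "x \<sqinter> (y \<squnion> \<star> y) = (x \<sqinter> y) \<squnion> (x \<sqinter> \<star> x)"
      using x y s by (simp add: meet_join_distrib skel_closed)
    also have "\<dots> = x \<sqinter> y"
      using x y by (metis star_meet_self meet_commute join_bottom skel_closed)
    finally have 1: "x \<sqinter> \<dagger> x \<sqsubseteq> x \<sqinter> y" .
    have "x = x \<sqinter> (y \<squnion> \<dagger> y)"
      using x y by (metis dstar_join_self join_commute meet_top dstar_closed)
    also have "\<dots> = (x \<sqinter> y) \<squnion> (x \<sqinter> \<dagger> x)"
      using x y d by (simp add: meet_join_distrib skel_closed)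
    also have "\<dots> = x \<sqinter> y"
      using 1 x y by (metis le_iff_join join_commute skel_closed)
    finally show ?thesis by (simp add: lat_le_def)
  qed
  then show ?thesis using assms by (simp add: le_antisym)
qed


section \<open>The representation\<close>

text \<open>Points need not be prime filters themselves. Toggling \<open>h\<close>, instead of
  tagging prime filters, doubles the points while keeping them of type \<open>'a set\<close>, as the
  type of \<open>U\<close> in the theorem demands.\<close>

definition points :: "('a, 'b) double_stone_alg_scheme \<Rightarrow> 'a \<Rightarrow> 'a set set"
  where "points L h = {P. \<exists>F. prime_filter L F \<and> P - {h} = F - {h}}"

definition twin :: "('a, 'b) double_stone_alg_scheme \<Rightarrow> 'a \<Rightarrow> ('a set \<times> 'a set) set"
  where "twin L h = {(P, Q). P \<in> points L h \<and> Q \<in> points L h \<and> P - {h} = Q - {h}}"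

text \<open>For a core element \<open>h\<close> of a nontrivial algebra, the components collect the
  points containing \<open>\<dagger> (\<dagger> x)\<close> and \<open>\<star> (\<star> x)\<close>,
  the closest skeletal approximations of \<open>x\<close> from below and above.\<close>

definition rough_rep ::
    "('a, 'b) double_stone_alg_scheme \<Rightarrow> 'a \<Rightarrow> 'a \<Rightarrow> 'a set set \<times> 'a set set"
  where "rough_rep L h x =
    ({P \<in> points L h. \<dagger>\<^bsub>L\<^esub> x \<notin> P}, {P \<in> points L h. \<star>\<^bsub>L\<^esub> x \<notin> P})"

section \<open>Blocks and approximations\<close>

lemma equiv_twin: "equiv (points L h) (twin L h)"
  by (rule equivI) (auto simp: twin_def refl_on_def sym_def trans_def)

lemma twin_class:
  assumes "P \<in> points L h"
  shows "twin L h `` {P} = {P - {h}, insert h P}"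
proof -
  have "P - {h} \<in> points L h" "insert h P \<in> points L h"
    using assms by (auto simp: points_def)
  then show ?thesis using assms by (auto simp: twin_def)
qed

text \<open>Since \<open>Q\<close> sees only the class, it holds at all members of a class or at
  none. Upper and lower approximation are two choices of \<open>Q\<close>.\<close>

lemma Union_equiv_classes:
  assumes "equiv U \<theta>"
  shows "\<Union> {\<theta> `` {x} | x. x \<in> U \<and> Q (\<theta> `` {x})} = {x \<in> U. Q (\<theta> `` {x})}"
proof (intro equalityI subsetI)
  fix y assume "y \<in> \<Union> {\<theta> `` {x} | x. x \<in> U \<and> Q (\<theta> `` {x})}"
  then obtain x where "Q (\<theta> `` {x})" "(x, y) \<in> \<theta>" by auto
  then show "y \<in> {x \<in> U. Q (\<theta> `` {x})}"
    using equiv_class_eq_iff[OF assms] by auto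
next
  fix y assume y: "y \<in> {x \<in> U. Q (\<theta> `` {x})}"
  then have "y \<in> \<theta> `` {y}" using equiv_class_self[OF assms] by blast
  then show "y \<in> \<Union> {\<theta> `` {x} | x. x \<in> U \<and> Q (\<theta> `` {x})}"
    using y by blast
qed

lemma upper_approx_eq:
  "equiv U \<theta> \<Longrightarrow> upper_approx U \<theta> X = {x \<in> U. \<theta> `` {x} \<inter> X \<noteq> {}}"
  unfolding upper_approx_def by (rule Union_equiv_classes)

lemma lower_approx_eq:
  "equiv U \<theta> \<Longrightarrow> lower_approx U \<theta> X = {x \<in> U. \<theta> `` {x} \<subseteq> X}"
  unfolding lower_approx_def by (rule Union_equiv_classes)

section \<open>The embedding into the rough set algebra\<close>

lemma (in double_stone_algebra) rough_rep_in_rough_sets: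
  assumes h: "h \<in> core L" and nontriv: "\<zero> \<noteq> \<one>" and x: "x \<in> carrier L"
  shows "rough_rep L h x \<in> rough_sets (points L h) (twin L h)"
proof -
  let ?U = "points L h" and ?\<theta> = "twin L h"
  \<comment> \<open>From each boundary block, only the member containing \<open>h\<close> is taken,
    so the block meets \<open>X\<close> without being contained in it.\<close>
  define X where "X = {P \<in> ?U. \<dagger> x \<notin> P \<or> (\<star> x \<notin> P \<and> h \<in> P)}"
  \<comment> \<open>Toggling \<open>h\<close> therefore never changes whether
    \<open>\<star> x\<close> or \<open>\<dagger> x\<close> belongs to a point, so both components
    are unions of blocks.\<close>
  have ne: "\<star> x \<noteq> h" "\<dagger> x \<noteq> h"
    using core_not_star[OF h nontriv x] core_not_dstar[OF h nontriv[symmetric] x] by auto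
  have U: "P - {h} \<in> ?U" "insert h P \<in> ?U" if "P \<in> ?U" for P
    using that by (auto simp: points_def)
  have mono: "\<dagger> x \<in> P" if "P \<in> ?U" "\<star> x \<in> P" for P
  proof -
    obtain F where F: "prime_filter L F" "P - {h} = F - {h}"
      using \<open>P \<in> ?U\<close> by (auto simp: points_def)
    then have "\<star> x \<in> F" using that ne by blast
    then have "\<dagger> x \<in> F"
      using F star_le_dstar[OF x] filter_up x dstar_closed by (auto simp: prime_filter_def)
    then show ?thesis using F ne by blast
  qed
  have "?\<theta> `` {P} \<subseteq> X \<longleftrightarrow> \<dagger> x \<notin> P" if "P \<in> ?U" for P
    unfolding twin_class[OF that] X_def using ne U[OF that] by auto
  then have "lower_approx ?U ?\<theta> X = {P \<in> ?U. \<dagger> x \<notin> P}"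
    unfolding lower_approx_eq[OF equiv_twin] by blast
  moreover have "?\<theta> `` {P} \<inter> X \<noteq> {} \<longleftrightarrow> \<star> x \<notin> P" if "P \<in> ?U" for P
    unfolding twin_class[OF that] X_def using ne U[OF that] mono[OF that] by auto
  then have "upper_approx ?U ?\<theta> X = {P \<in> ?U. \<star> x \<notin> P}"
    unfolding upper_approx_eq[OF equiv_twin] by blast
  moreover have "X \<subseteq> ?U" by (auto simp: X_def)
  ultimately show ?thesis unfolding rough_sets_def rough_rep_def by blast
qed

text \<open>A point differs from some prime filter at most at \<open>h\<close>, and no skeletal
  element equals \<open>h\<close>. Prime filter laws for skeletal elements thus transfer to
  points.\<close>

lemma (in double_stone_algebra) points_skeletal:
  assumes h: "h \<in> core L" and nontriv: "\<zero> \<noteq> \<one>" and P: "P \<in> points L h"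
  obtains F where "prime_filter L F"
    "\<And>x. x \<in> carrier L \<Longrightarrow> \<star> x \<in> P \<longleftrightarrow> \<star> x \<in> F"
    "\<And>x. x \<in> carrier L \<Longrightarrow> \<dagger> x \<in> P \<longleftrightarrow> \<dagger> x \<in> F"
proof -
  obtain F where F: "prime_filter L F" "P - {h} = F - {h}"
    using P by (auto simp: points_def)
  show ?thesis
    using that[OF F(1)] F(2) core_not_star[OF h nontriv] core_not_dstar[OF h nontriv[symmetric]] by blast
qed

lemma (in double_stone_algebra) rough_rep_hom:
  assumes h: "h \<in> core L" and nontriv: "\<zero> \<noteq> \<one>"
  defines "R \<equiv> rough_set_algebra (points L h) (twin L h)"
  shows "\<lbrakk>x \<in> carrier L; y \<in> carrier L\<rbrakk>
      \<Longrightarrow> rough_rep L h (x \<squnion> y) = rough_rep L h x \<squnion>\<^bsub>R\<^esub> rough_rep L h y"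
    and "\<lbrakk>x \<in> carrier L; y \<in> carrier L\<rbrakk>
      \<Longrightarrow> rough_rep L h (x \<sqinter> y) = rough_rep L h x \<sqinter>\<^bsub>R\<^esub> rough_rep L h y"
    and "x \<in> carrier L \<Longrightarrow> rough_rep L h (\<star> x) = \<star>\<^bsub>R\<^esub> (rough_rep L h x)"
    and "x \<in> carrier L \<Longrightarrow> rough_rep L h (\<dagger> x) = \<dagger>\<^bsub>R\<^esub> (rough_rep L h x)"
    and "rough_rep L h \<zero> = \<zero>\<^bsub>R\<^esub>"
    and "rough_rep L h \<one> = \<one>\<^bsub>R\<^esub>"
proof -
  let ?U = "points L h"
  \<comment> \<open>The De Morgan laws for both complements become the componentwise unions and
    intersections of \<open>R\<close>, as \<open>rough_rep\<close> records non-membership.\<close>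
  have xy: "(\<star> (x \<squnion> y) \<in> P \<longleftrightarrow> \<star> x \<in> P \<and> \<star> y \<in> P) \<and>
      (\<dagger> (x \<squnion> y) \<in> P \<longleftrightarrow> \<dagger> x \<in> P \<and> \<dagger> y \<in> P) \<and>
      (\<star> (x \<sqinter> y) \<in> P \<longleftrightarrow> \<star> x \<in> P \<or> \<star> y \<in> P) \<and>
      (\<dagger> (x \<sqinter> y) \<in> P \<longleftrightarrow> \<dagger> x \<in> P \<or> \<dagger> y \<in> P)"
    if P: "P \<in> ?U" and x: "x \<in> carrier L" and y: "y \<in> carrier L" for P x y
  proof -
    obtain F where F: "prime_filter L F"
      and mem: "\<And>x. x \<in> carrier L \<Longrightarrow> \<star> x \<in> P \<longleftrightarrow> \<star> x \<in> F"
        "\<And>x. x \<in> carrier L \<Longrightarrow> \<dagger> x \<in> P \<longleftrightarrow> \<dagger> x \<in> F"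
      using points_skeletal[OF h nontriv P] by blast
    show ?thesis
      using F x y mem(1)[of "x \<squnion> y"] mem(1)[of "x \<sqinter> y"]
        mem(2)[of "x \<squnion> y"] mem(2)[of "x \<sqinter> y"]
      by (simp add: mem skel_closed star_join star_meet dstar_join dstar_meet
          prime_filter_def lat_filter_def)
  qed
  \<comment> \<open>Both complements of a skeletal element act as negation at a point. Hence the
    images of \<open>\<star> x\<close> and \<open>\<dagger> x\<close> have equal components, as in
    \<open>R\<close>.\<close>
  have skel: "(\<star> (\<star> x) \<in> P \<longleftrightarrow> \<star> x \<notin> P) \<and> (\<dagger> (\<star> x) \<in> P \<longleftrightarrow> \<star> x \<notin> P) \<and>
      (\<dagger> (\<dagger> x) \<in> P \<longleftrightarrow> \<dagger> x \<notin> P) \<and> (\<star> (\<dagger> x) \<in> P \<longleftrightarrow> \<dagger> x \<notin> P)"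
    if P: "P \<in> ?U" and x: "x \<in> carrier L" for P x
  proof -
    obtain F where F: "prime_filter L F"
      and mem: "\<And>x. x \<in> carrier L \<Longrightarrow> \<star> x \<in> P \<longleftrightarrow> \<star> x \<in> F"
        "\<And>x. x \<in> carrier L \<Longrightarrow> \<dagger> x \<in> P \<longleftrightarrow> \<dagger> x \<in> F"
      using points_skeletal[OF h nontriv P] by blast
    show ?thesis
      using prime_star_star[OF F x] prime_dstar_dstar[OF F x] x
      by (simp add: mem skel_closed)
  qed
  have const: "\<star> \<zero> \<in> P \<and> \<dagger> \<zero> \<in> P \<and> \<star> \<one> \<notin> P \<and> \<dagger> \<one> \<notin> P" if P: "P \<in> ?U" for P
  proof -
    obtain F where F: "prime_filter L F"
      and mem: "\<And>x. x \<in> carrier L \<Longrightarrow> \<star> x \<in> P \<longleftrightarrow> \<star> x \<in> F"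
        "\<And>x. x \<in> carrier L \<Longrightarrow> \<dagger> x \<in> P \<longleftrightarrow> \<dagger> x \<in> F"
      using points_skeletal[OF h nontriv P] by blast
    show ?thesis
      using F mem[of \<zero>] mem[of \<one>]
      by (simp add: skel_closed star_bottom star_top dstar_bottom dstar_top
          prime_filter_def lat_filter_def)
  qed
  note defs = R_def rough_rep_def rough_set_algebra_def
  show "rough_rep L h (x \<squnion> y) = rough_rep L h x \<squnion>\<^bsub>R\<^esub> rough_rep L h y"
    "rough_rep L h (x \<sqinter> y) = rough_rep L h x \<sqinter>\<^bsub>R\<^esub> rough_rep L h y"
    if "x \<in> carrier L" "y \<in> carrier L"
    using xy[OF _ that] by (auto simp: defs)
  show "rough_rep L h (\<star> x) = \<star>\<^bsub>R\<^esub> (rough_rep L h x)"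
    "rough_rep L h (\<dagger> x) = \<dagger>\<^bsub>R\<^esub> (rough_rep L h x)"
    if "x \<in> carrier L"
    using skel[OF _ that] by (auto simp: defs)
  show "rough_rep L h \<zero> = \<zero>\<^bsub>R\<^esub>" "rough_rep L h \<one> = \<one>\<^bsub>R\<^esub>"
    using const by (auto simp: defs)
qed

text \<open>Every prime filter is itself a point, so equal images give skeletal elements lying in
  the same prime filters, hence equal ones; regularity then recovers the element.\<close>

lemma (in regular_double_stone_algebra) inj_on_rough_rep:
  assumes h: "h \<in> core L" and nontriv: "\<zero> \<noteq> \<one>"
  shows "inj_on (rough_rep L h) (carrier L)"
proof (rule inj_onI)
  fix x y assume x: "x \<in> carrier L" and y: "y \<in> carrier L"
    and eq: "rough_rep L h x = rough_rep L h y"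
  have agree: "(\<star> x \<in> F \<longleftrightarrow> \<star> y \<in> F) \<and> (\<dagger> x \<in> F \<longleftrightarrow> \<dagger> y \<in> F)"
    if F: "prime_filter L F" for F
  proof -
    have "F \<in> points L h" using F by (auto simp: points_def)
    then show ?thesis using eq unfolding rough_rep_def by blast
  qed
  show "x = y"
  proof (rule regular_eqI[OF x y])
    show "\<star> x = \<star> y"
      using agree by (intro eq_if_prime_filters_agree star_closed x y) blast
    show "\<dagger> x = \<dagger> y"
      using agree by (intro eq_if_prime_filters_agree dstar_closed x y) blast
  qed
qed

lemma subalgebra_isomorphic_image:
  assumes closed: "\<And>x y. \<lbrakk>x \<in> carrier A; y \<in> carrier A\<rbrakk>
      \<Longrightarrow> x \<squnion>\<^bsub>A\<^esub> y \<in> carrier A \<and> x \<sqinter>\<^bsub>A\<^esub> y \<in> carrier A"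
    "\<And>x. x \<in> carrier A \<Longrightarrow> \<star>\<^bsub>A\<^esub> x \<in> carrier A \<and> \<dagger>\<^bsub>A\<^esub> x \<in> carrier A"
    "\<zero>\<^bsub>A\<^esub> \<in> carrier A" "\<one>\<^bsub>A\<^esub> \<in> carrier A"
    and inj: "inj_on f (carrier A)" and image: "f ` carrier A \<subseteq> carrier B"
    and hom: "\<And>x y. \<lbrakk>x \<in> carrier A; y \<in> carrier A\<rbrakk> \<Longrightarrow> f (x \<squnion>\<^bsub>A\<^esub> y) = f x \<squnion>\<^bsub>B\<^esub> f y"
      "\<And>x y. \<lbrakk>x \<in> carrier A; y \<in> carrier A\<rbrakk> \<Longrightarrow> f (x \<sqinter>\<^bsub>A\<^esub> y) = f x \<sqinter>\<^bsub>B\<^esub> f y"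
      "\<And>x. x \<in> carrier A \<Longrightarrow> f (\<star>\<^bsub>A\<^esub> x) = \<star>\<^bsub>B\<^esub> (f x)"
      "\<And>x. x \<in> carrier A \<Longrightarrow> f (\<dagger>\<^bsub>A\<^esub> x) = \<dagger>\<^bsub>B\<^esub> (f x)"
      "f \<zero>\<^bsub>A\<^esub> = \<zero>\<^bsub>B\<^esub>" "f \<one>\<^bsub>A\<^esub> = \<one>\<^bsub>B\<^esub>"
  shows "subalgebra (f ` carrier A) B" "isomorphic A (B\<lparr>carrier := f ` carrier A\<rparr>)"
proof -
  show "subalgebra (f ` carrier A) B"
    using closed image unfolding subalgebra_def
    by (auto simp: hom(1-4)[symmetric] hom(5,6)[symmetric])
  have "is_isomorphism f A (B\<lparr>carrier := f ` carrier A\<rparr>)"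
    using inj by (simp add: is_isomorphism_def bij_betw_def hom)
  then show "isomorphic A (B\<lparr>carrier := f ` carrier A\<rparr>)"
    unfolding isomorphic_def by blast
qed

theorem proposition6:
  fixes L :: "'a double_stone_alg"
  assumes "core_regular_double_stone_algebra L"
    and nontrivial: "\<zero>\<^bsub>L\<^esub> \<noteq> \<one>\<^bsub>L\<^esub>"
  shows "\<exists>(U :: 'a set set) \<theta> S.
    approximation_space U \<theta> \<and>
    subalgebra S (rough_set_algebra U \<theta>) \<and>
    isomorphic L ((rough_set_algebra U \<theta>)\<lparr>carrier := S\<rparr>)"
proof -
  interpret core_regular_double_stone_algebra L by fact
  obtain h where h: "h \<in> core L" using core_nonempty by blast
  let ?U = "points L h" and ?\<theta> = "twin L h"
  let ?f = "rough_rep L h" and ?R = "rough_set_algebra ?U ?\<theta>"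
  \<comment> \<open>Nontriviality supplies a prime filter, separating \<open>\<one>\<close> from
    \<open>\<zero>\<close>; it witnesses that the universe is nonempty.\<close>
  have "\<not> \<one>\<^bsub>L\<^esub> \<sqsubseteq>\<^bsub>L\<^esub> \<zero>\<^bsub>L\<^esub>"
    using nontrivial le_antisym[OF bottom_closed top_closed] le_top[OF bottom_closed] by blast
  then obtain F where "prime_filter L F"
    using prime_filter_separation[OF top_closed bottom_closed] by blast
  then have "approximation_space ?U ?\<theta>"
    using equiv_twin by (auto simp: approximation_space_def points_def)
  moreover have "?f ` carrier L \<subseteq> carrier ?R"
    using rough_rep_in_rough_sets[OF h nontrivial] by (auto simp: rough_set_algebra_def)
  then have "subalgebra (?f ` carrier L) ?R" "isomorphic L (?R\<lparr>carrier := ?f ` carrier L\<rparr>)"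
    using subalgebra_isomorphic_image[of L ?f ?R]
      inj_on_rough_rep[OF h nontrivial] rough_rep_hom[OF h nontrivial]
    by (simp_all add: skel_closed)
  ultimately show ?thesis by blast
qed

end
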